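(* The completed dual-grid configuration $\widehat Z_3$ is orthogonally equivalent to the projectivized $F_4$ root configuration, or equivalently to the Peres $24$-ray configuration.
   Context: Work in $\mathbb R^4=\mathbb R^2\oplus\mathbb R^2$ with the standard Euclidean inner product; rays are points of $\mathbb P^3(\mathbb R)$. Two sets of rays are orthogonally equivalent if some element of $O(4)$ maps one onto the other. $\widehat Z_3$: let $\alpha=\beta=2\pi/3$ (cyclic steps $a=b=1$), $c=\sqrt2$, $u(\theta)=(\cos\theta,\sin\theta)$. For $(i,j)\in\mathbb Z_3^2$ let $A_{ij}=[u(i\alpha-j\beta):-c\,u(i\alpha+j\beta)]$, $B_{ij}=[c\,u(i\alpha-j\beta):u(i\alpha+j\beta)]$, and for $r\in\mathbb Z_3$ let $P_r=[u(\tfrac{\pi}{2}+\tfrac{2\pi r}{3}):0]$, $P'_r=[0:u(\tfrac{\pi}{2}+\tfrac{2\pi r}{3})]$. Then $\widehat Z_3=\{A_{ij}\}\sqcup\{B_{ij}\}\sqcup\{P_r\}\sqcup\{P'_r\}$. The Peres $24$-ray configuration consists of the rays spanned by the four standard basis vectors $e_i$, the eight vectors $(1,\pm1,\pm1,\pm1)$, and the twelve vectors $e_i\pm e_j$ ($1\le i<j\le4$); these are the rays spanned by the roots of the root system $F_4$ (the projectivized $F_4$ root configuration). *)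

theory Defs
  imports "HOL-Analysis.Analysis"
begin

(* The point of projective 3-space given by v is the line spanned by v; it is only
   meant for nonzero v, and all the vectors used below are nonzero. *)
definition ray :: "real ^ 4 \<Rightarrow> (real ^ 4) set" where
  "ray v = span {v}"

definition orthogonally_equivalent :: "(real ^ 4) set set \<Rightarrow> (real ^ 4) set set \<Rightarrow> bool" where
  "orthogonally_equivalent R S \<longleftrightarrow>
     (\<exists>f. orthogonal_transformation f \<and> (\<lambda>L. f ` L) ` R = S)"

(* The identification of the direct sum of two copies of R^2 with R^4. *)
definition join :: "real ^ 2 \<Rightarrow> real ^ 2 \<Rightarrow> real ^ 4" where
  "join x y = vector [x $ 1, x $ 2, y $ 1, y $ 2]"

definition u :: "real \<Rightarrow> real ^ 2" where
  "u \<theta> = vector [cos \<theta>, sin \<theta>]"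

definition ray_A :: "real \<Rightarrow> real \<Rightarrow> real \<Rightarrow> nat \<Rightarrow> nat \<Rightarrow> (real ^ 4) set" where
  "ray_A \<alpha> \<beta> c i j =
     ray (join (u (real i * \<alpha> - real j * \<beta>)) (- c *\<^sub>R u (real i * \<alpha> + real j * \<beta>)))"

definition ray_B :: "real \<Rightarrow> real \<Rightarrow> real \<Rightarrow> nat \<Rightarrow> nat \<Rightarrow> (real ^ 4) set" where
  "ray_B \<alpha> \<beta> c i j =
     ray (join (c *\<^sub>R u (real i * \<alpha> - real j * \<beta>)) (u (real i * \<alpha> + real j * \<beta>)))"

definition ray_P :: "nat \<Rightarrow> (real ^ 4) set" where
  "ray_P r = ray (join (u (pi / 2 + 2 * pi * real r / 3)) 0)"

definition ray_P' :: "nat \<Rightarrow> (real ^ 4) set" where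
  "ray_P' r = ray (join 0 (u (pi / 2 + 2 * pi * real r / 3)))"

(* Indices in Z/3 are represented by 0, 1, 2; u is 2 pi periodic, so the choice of
   representatives does not matter. *)
definition Z3_hat :: "(real ^ 4) set set" where
  "Z3_hat =
     (let \<alpha> = 2 * pi / 3; \<beta> = 2 * pi / 3; c = sqrt 2 in
       {ray_A \<alpha> \<beta> c i j | i j. i < 3 \<and> j < 3} \<union> {ray_B \<alpha> \<beta> c i j | i j. i < 3 \<and> j < 3} \<union>
       {ray_P r | r. r < 3} \<union> {ray_P' r | r. r < 3})"

(* The 48 roots of F4 in the standard coordinates: the 24 long roots, of squared length 2,
   and the 8 + 16 short roots, of squared length 1. *)
definition F4_roots :: "(real ^ 4) set" where
  "F4_roots =
     {s *\<^sub>R axis i 1 + t *\<^sub>R axis j 1 | s t i j. s \<in> {1, -1} \<and> t \<in> {1, -1} \<and> i \<noteq> j} \<union>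
     {s *\<^sub>R axis i 1 | s i. s \<in> {1, -1}} \<union>
     {(1 / 2) *\<^sub>R vector [s1, s2, s3, s4] | s1 s2 s3 s4.
        s1 \<in> {1, -1} \<and> s2 \<in> {1, -1} \<and> s3 \<in> {1, -1} \<and> s4 \<in> {1, -1}}"

definition F4_rays :: "(real ^ 4) set set" where
  "F4_rays = ray ` F4_roots"

(* Exchanging i and j changes the sign of e_i - e_j only, so unordered and ordered
   pairs i, j give the same rays. *)
definition Peres_rays :: "(real ^ 4) set set" where
  "Peres_rays =
     {ray (axis i 1) | i. True} \<union>
     {ray (vector [1, s2, s3, s4]) | s2 s3 s4.
        s2 \<in> {1, -1} \<and> s3 \<in> {1, -1} \<and> s4 \<in> {1, -1}} \<union>
     {ray (axis i 1 + s *\<^sub>R axis j 1) | s i j. s \<in> {1, -1} \<and> i \<noteq> j}"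

lemma vector_4 [simp]:
  "(vector [w, x, y, z] :: 'a :: zero ^ 4) $ 1 = w"
  "(vector [w, x, y, z] :: 'a :: zero ^ 4) $ 2 = x"
  "(vector [w, x, y, z] :: 'a :: zero ^ 4) $ 3 = y"
  "(vector [w, x, y, z] :: 'a :: zero ^ 4) $ 4 = z"
  by (simp_all add: vector_def)

end

theory Submission
  imports Defs
begin

text \<open>The root system \<open>F\<^sub>4\<close> contains an orthogonal pair of subsystems of type \<open>A\<^sub>2\<close>, a long one
  in the plane \<open>x\<^sub>1 + x\<^sub>2 + x\<^sub>3 = 0, x\<^sub>4 = 0\<close> and a short one in the plane spanned by \<open>(1,1,1,0)\<close> and
  \<open>e\<^sub>4\<close>. Send the two summands of \<open>\<real>\<^sup>2 \<oplus> \<real>\<^sup>2\<close> isometrically onto these planes, with \<open>u(0)\<close> going to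
  the directions of \<open>(2,-1,-1,0)\<close> and \<open>(1,1,1,0)\<close>. The rays \<open>P\<^sub>r\<close> and \<open>P'\<^sub>r\<close> then become the roots
  inside the two planes. Any other root has projections to the two planes whose lengths are in
  ratio \<open>1 : \<surd>2\<close> if it is long and \<open>\<surd>2 : 1\<close> if it is short; these are the rays
  \<open>A\<^sub>i\<^sub>j\<close> and \<open>B\<^sub>i\<^sub>j\<close>.\<close>

section \<open>Rays in homogeneous coordinates\<close>

lemma ray_scale: "c \<noteq> 0 \<Longrightarrow> ray (c *\<^sub>R v) = ray v"
  unfolding ray_def using span_image_scale[of "{v}" "\<lambda>_. c"] by simp

lemma vector4_scale:
  "vector [c * w, c * x, c * y, c * z] = c *\<^sub>R (vector [w, x, y, z] :: real ^ 4)"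
  by (simp add: vec_eq_iff forall_4)

lemma ray_vector_scale:
  "c \<noteq> 0 \<Longrightarrow> ray (vector [c * w, c * x, c * y, c * z]) = ray (vector [w, x, y, z])"
  by (simp add: vector4_scale ray_scale)

text \<open>These rules normalise the first nonzero coordinate to 1; the premises \<open>\<dots> \<noteq> 1\<close> keep the
  simplifier from looping.\<close>

lemma ray_vector_normalize:
  "a \<noteq> 0 \<Longrightarrow> a \<noteq> 1 \<Longrightarrow> ray (vector [a, b, c, d]) = ray (vector [1, b / a, c / a, d / a])"
  "b \<noteq> 0 \<Longrightarrow> b \<noteq> 1 \<Longrightarrow> ray (vector [0, b, c, d]) = ray (vector [0, 1, c / b, d / b])"
  "c \<noteq> 0 \<Longrightarrow> c \<noteq> 1 \<Longrightarrow> ray (vector [0, 0, c, d]) = ray (vector [0, 0, 1, d / c])"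
  "d \<noteq> 0 \<Longrightarrow> d \<noteq> 1 \<Longrightarrow> ray (vector [0, 0, 0, d]) = ray (vector [0, 0, 0, 1])"
  using ray_vector_scale[of a 1 "b / a" "c / a" "d / a"]
    ray_vector_scale[of b 0 1 "c / b" "d / b"]
    ray_vector_scale[of c 0 0 1 "d / c"] ray_vector_scale[of d 0 0 0 1]
  by simp_all

lemma image_ray: "linear f \<Longrightarrow> f ` ray v = ray (f v)"
  by (simp add: ray_def linear_span_image[symmetric])

section \<open>Cosines and sines of the multiples of 2 pi / 3\<close>

definition cos_third :: "int \<Rightarrow> real" where
  "cos_third k = (if k mod 3 = 0 then 1 else - 1 / 2)"

text \<open>The factor \<open>sqrt 3\<close> of the sine is split off to keep the values rational,
  so that comparing rays later needs only rational arithmetic.\<close>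

definition sin_third :: "int \<Rightarrow> real" where
  "sin_third k = (if k mod 3 = 0 then 0 else if k mod 3 = 1 then 1 / 2 else - 1 / 2)"

text \<open>By periodicity only the residue of \<open>k\<close> modulo 3 matters. Integers are
  needed since the grid index \<open>i - j\<close> may be negative.\<close>

lemma cos_sin_third:
  "cos (2 * pi * of_int k / 3) = cos_third k \<and> sin (2 * pi * of_int k / 3) = sqrt 3 * sin_third k"
proof -
  define m where "m = k mod 3"
  have k: "k = 3 * (k div 3) + m"
    by (simp add: m_def)
  have "2 * pi * real_of_int k / 3 = 2 * pi * real_of_int m / 3 + 2 * pi * of_int (k div 3)"
    by (subst k) (simp add: field_simps)
  hence *: "cos (2 * pi * of_int k / 3) = cos (2 * pi * of_int m / 3)"
    "sin (2 * pi * of_int k / 3) = sin (2 * pi * of_int m / 3)"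
    by (simp_all only: cos_add sin_add sin_int_2pin cos_int_2pin mult_1_right mult_zero_right diff_0_right add_0_right)
  have "m \<in> {0, 1, 2}"
    by (auto simp: m_def)
  \<comment> \<open>Both angles are reflected to pi / 3, whose cosine and sine are known.\<close>
  moreover have "2 * pi * 2 / 3 = pi + pi / 3" "2 * pi / 3 = pi - pi / 3"
    by simp_all
  hence "cos (2 * pi / 3) = - 1 / 2" "sin (2 * pi / 3) = sqrt 3 / 2"
    "cos (2 * pi * 2 / 3) = - 1 / 2" "sin (2 * pi * 2 / 3) = - sqrt 3 / 2"
    by (simp_all only: cos_add cos_diff sin_add sin_diff) (simp_all add: cos_60 sin_60)
  ultimately show ?thesis
    unfolding * by (auto simp: cos_third_def sin_third_def m_def[symmetric])
qed

lemma u_third: "u (2 * pi * of_int k / 3) = vector [cos_third k, sqrt 3 * sin_third k]"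
  by (simp add: u_def cos_sin_third)

lemma u_third_rotated:
  "u (pi / 2 + 2 * pi * of_int k / 3) = vector [- sqrt 3 * sin_third k, cos_third k]"
  by (simp add: u_def cos_add sin_add cos_sin_third)

section \<open>The isometry\<close>

text \<open>The standard basis goes to the orthonormal basis (2,-1,-1,0) / sqrt 6, (0,1,-1,0) / sqrt
  2, (1,1,1,0) / sqrt 3, (0,0,0,1); the first two vectors span the long plane, the last two the
  short one.\<close>

definition grid_map :: "real ^ 4 \<Rightarrow> real ^ 4" where
  "grid_map v =
     (let a = v $ 1 / sqrt 6; b = v $ 2 / sqrt 2; c = v $ 3 / sqrt 3
      in vector [2 * a + c, - a + b + c, - a - b + c, v $ 4])"

lemma orthogonal_grid_map: "orthogonal_transformation grid_map"
  unfolding orthogonal_transformation_def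
proof
  show "linear grid_map"
    by (rule linearI)
      (simp_all add: grid_map_def Let_def vec_eq_iff forall_4 add_divide_distrib algebra_simps)
  have "grid_map v \<bullet> grid_map w = v \<bullet> w" for v w
  proof -
    define a b c a' b' c' where abc:
      "a = v $ 1 / sqrt 6" "b = v $ 2 / sqrt 2" "c = v $ 3 / sqrt 3"
      "a' = w $ 1 / sqrt 6" "b' = w $ 2 / sqrt 2" "c' = w $ 3 / sqrt 3"
    \<comment> \<open>The mixed terms cancel by orthogonality of (2,-1,-1), (0,1,-1), (1,1,1); their
      squared lengths 6, 2, 3 offset the denominators in \<open>abc\<close>.\<close>
    have "grid_map v \<bullet> grid_map w = 6 * (a * a') + 2 * (b * b') + 3 * (c * c') + v $ 4 * w $ 4"
      by (simp add: grid_map_def Let_def inner_vec_def sum_4 abc[symmetric] algebra_simps)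
    also have "\<dots> = v \<bullet> w"
      by (simp add: abc inner_vec_def sum_4)
    finally show ?thesis .
  qed
  thus "\<forall>v w. grid_map v \<bullet> grid_map w = v \<bullet> w"
    by blast
qed

lemma linear_grid_map: "linear grid_map"
  using orthogonal_grid_map by (simp add: orthogonal_transformation_def)

lemma sqrt_6: "sqrt 6 = sqrt 2 * sqrt 3"
  by (simp flip: real_sqrt_mult)

section \<open>Images of the four families of rays\<close>

text \<open>With the weight \<open>sqrt 2\<close>, all four coordinates of the image are rational
  multiples of 1 / sqrt 6, a factor that the ray forgets. For the families B and P the common factor
  is 1 / sqrt 3 and 1 / sqrt 2.\<close>

lemma grid_map_A:
  "grid_map ` ray_A (2 * pi / 3) (2 * pi / 3) (sqrt 2) i j =
   (let x = cos_third (int i - int j); y = sin_third (int i - int j);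
        x' = cos_third (int i + int j); y' = sin_third (int i + int j)
    in ray (vector [2 * x - 2 * x', - x + 3 * y - 2 * x', - x - 3 * y - 2 * x', - 6 * y']))"
proof -
  define x y x' y' where xy: "x = cos_third (int i - int j)" "y = sin_third (int i - int j)"
    "x' = cos_third (int i + int j)" "y' = sin_third (int i + int j)"
  have angles: "real i * (2 * pi / 3) - real j * (2 * pi / 3) = 2 * pi * of_int (int i - int j) / 3"
    "real i * (2 * pi / 3) + real j * (2 * pi / 3) = 2 * pi * of_int (int i + int j) / 3"
    by (simp_all add: field_simps)
  have "grid_map (join (vector [x, sqrt 3 * y]) (- sqrt 2 *\<^sub>R vector [x', sqrt 3 * y'])) =
    vector [(1 / sqrt 6) * (2 * x - 2 * x'), (1 / sqrt 6) * (- x + 3 * y - 2 * x'),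
      (1 / sqrt 6) * (- x - 3 * y - 2 * x'), (1 / sqrt 6) * (- 6 * y')]"
    by (simp add: grid_map_def join_def Let_def vec_eq_iff forall_4 sqrt_6 field_simps)
  thus ?thesis
    unfolding ray_A_def angles u_third xy[symmetric] Let_def image_ray[OF linear_grid_map]
    by (simp only:) (rule ray_vector_scale, simp)
qed

lemma grid_map_B:
  "grid_map ` ray_B (2 * pi / 3) (2 * pi / 3) (sqrt 2) i j =
   (let x = cos_third (int i - int j); y = sin_third (int i - int j);
        x' = cos_third (int i + int j); y' = sin_third (int i + int j)
    in ray (vector [2 * x + x', - x + 3 * y + x', - x - 3 * y + x', 3 * y']))"
proof -
  define x y x' y' where xy: "x = cos_third (int i - int j)" "y = sin_third (int i - int j)"
    "x' = cos_third (int i + int j)" "y' = sin_third (int i + int j)"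
  have angles: "real i * (2 * pi / 3) - real j * (2 * pi / 3) = 2 * pi * of_int (int i - int j) / 3"
    "real i * (2 * pi / 3) + real j * (2 * pi / 3) = 2 * pi * of_int (int i + int j) / 3"
    by (simp_all add: field_simps)
  have "grid_map (join (sqrt 2 *\<^sub>R vector [x, sqrt 3 * y]) (vector [x', sqrt 3 * y'])) =
    vector [(1 / sqrt 3) * (2 * x + x'), (1 / sqrt 3) * (- x + 3 * y + x'),
      (1 / sqrt 3) * (- x - 3 * y + x'), (1 / sqrt 3) * (3 * y')]"
    by (simp add: grid_map_def join_def Let_def vec_eq_iff forall_4 sqrt_6 field_simps)
  thus ?thesis
    unfolding ray_B_def angles u_third xy[symmetric] Let_def image_ray[OF linear_grid_map]
    by (simp only:) (rule ray_vector_scale, simp)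
qed

lemma grid_map_P:
  "grid_map ` ray_P r =
   (let x = cos_third (int r); y = sin_third (int r)
    in ray (vector [- 2 * y, x + y, y - x, 0]))"
proof -
  define x y where xy: "x = cos_third (int r)" "y = sin_third (int r)"
  have "grid_map (join (vector [- sqrt 3 * y, x]) 0) =
    vector [(1 / sqrt 2) * (- 2 * y), (1 / sqrt 2) * (x + y), (1 / sqrt 2) * (y - x), (1 / sqrt 2) * 0]"
    by (simp add: grid_map_def join_def Let_def vec_eq_iff forall_4 sqrt_6 field_simps)
  thus ?thesis
    using u_third_rotated[of "int r"]
    unfolding ray_P_def xy[symmetric] Let_def image_ray[OF linear_grid_map]
    by (simp only: of_int_of_nat_eq) (rule ray_vector_scale, simp)
qed

lemma grid_map_P':
  "grid_map ` ray_P' r =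
   (let x = cos_third (int r); y = sin_third (int r) in ray (vector [- y, - y, - y, x]))"
  using u_third_rotated[of "int r"]
  unfolding ray_P'_def Let_def image_ray[OF linear_grid_map]
  by (simp add: grid_map_def join_def)

section \<open>Enumeration of the rays\<close>

lemma indexed_by_3:
  "{g r | r. r < (3::nat)} = {g 0, g 1, g 2}"
  "{h i j | i j. i < (3::nat) \<and> j < (3::nat)} =
     {h 0 0, h 0 1, h 0 2, h 1 0, h 1 1, h 1 2, h 2 0, h 2 1, h 2 2}"
  by (force simp: less_Suc_eq numeral_3_eq_3 numeral_2_eq_2)+

text \<open>One vector per ray, with first nonzero coordinate 1. This is the normal form of
  \<open>ray_vector_normalize\<close>, so equal rays become syntactically equal terms.\<close>

definition Peres_representatives :: "(real ^ 4) set" where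
  "Peres_representatives =
     {vector [1, 0, 0, 0], vector [0, 1, 0, 0], vector [0, 0, 1, 0], vector [0, 0, 0, 1],
      vector [1, 1, 1, 1], vector [1, 1, 1, -1], vector [1, 1, -1, 1], vector [1, 1, -1, -1],
      vector [1, -1, 1, 1], vector [1, -1, 1, -1], vector [1, -1, -1, 1], vector [1, -1, -1, -1],
      vector [1, 1, 0, 0], vector [1, -1, 0, 0], vector [1, 0, 1, 0], vector [1, 0, -1, 0],
      vector [1, 0, 0, 1], vector [1, 0, 0, -1], vector [0, 1, 1, 0], vector [0, 1, -1, 0],
      vector [0, 1, 0, 1], vector [0, 1, 0, -1], vector [0, 0, 1, 1], vector [0, 0, 1, -1]}"

lemma axis_4:
  "axis 1 1 = (vector [1, 0, 0, 0] :: real ^ 4)" "axis 2 1 = (vector [0, 1, 0, 0] :: real ^ 4)"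
  "axis 3 1 = (vector [0, 0, 1, 0] :: real ^ 4)" "axis 4 1 = (vector [0, 0, 0, 1] :: real ^ 4)"
  by (simp_all add: vec_eq_iff forall_4 axis_def)

lemma vector4_add:
  "vector [a, b, c, d] + vector [a', b', c', d'] = (vector [a + a', b + b', c + c', d + d'] :: real ^ 4)"
  by (simp add: vec_eq_iff forall_4)

lemma indexed_by_4: "{f i | i :: 4. True} = {f 1, f 2, f 3, f 4}"
proof -
  have "{f i | i :: 4. True} = f ` UNIV"
    by blast
  thus ?thesis
    unfolding UNIV_4 by (simp only: image_insert image_empty)
qed

lemma indexed_by_distinct_4:
  fixes g :: "'a \<Rightarrow> 4 \<Rightarrow> 4 \<Rightarrow> 'b"
  shows "{g s i j | s i j. s \<in> S \<and> i \<noteq> j} =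
    (\<Union>s\<in>S. {g s 4 1, g s 4 2, g s 4 3, g s 3 1, g s 3 2, g s 3 4,
      g s 2 1, g s 2 3, g s 2 4, g s 1 2, g s 1 3, g s 1 4})"
proof -
  have "UNIV - {1 :: 4} = {2, 3, 4}" "UNIV - {2 :: 4} = {1, 3, 4}"
    "UNIV - {3 :: 4} = {1, 2, 4}" "UNIV - {4 :: 4} = {1, 2, 3}"
    by (simp_all add: set_eq_iff forall_4)
  moreover have "{g s i j | s i j. s \<in> S \<and> i \<noteq> j} =
      (\<Union>s\<in>S. \<Union>i\<in>UNIV. (\<lambda>j. g s i j) ` (UNIV - {i}))"
    by blast
  ultimately show ?thesis
    by (simp only: UNIV_4 image_insert image_empty Union_insert Union_empty
        Un_insert_left Un_insert_right Un_empty_left Un_empty_right)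
qed

lemma indexed_by_signs:
  "{g a b c | a b c. a \<in> {1, -1} \<and> b \<in> {1, -1} \<and> c \<in> {1, - 1 :: real}} =
   {g 1 1 1, g 1 1 (-1), g 1 (-1) 1, g 1 (-1) (-1),
    g (-1) 1 1, g (-1) 1 (-1), g (-1) (-1) 1, g (-1) (-1) (-1)}"
  by blast

text \<open>In the next two proofs \<open>Peres_representatives\<close> is unfolded only after the left-hand side is in
  normal form: an unrestricted \<open>simp\<close> on an equation between the two enumerated sets is
  prohibitively slow.\<close>

lemma Peres_rays_eq: "Peres_rays = ray ` Peres_representatives"
  unfolding Peres_rays_def indexed_by_4 indexed_by_signs indexed_by_distinct_4
  apply (simp only: UN_insert UN_empty Un_insert_left Un_empty_left Un_empty_right axis_4)
  apply (simp add: vector4_scale[symmetric] vector4_add ray_vector_normalize)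
  apply (simp only: Peres_representatives_def image_insert image_empty)
  apply (intro equalityI; simp only: insert_subset empty_subsetI insert_iff simp_thms)
  \<comment> \<open>Each normalised ray on one side occurs literally on the other, so propositional
    simplification settles every membership.\<close>
  done

lemma grid_map_Z3_hat: "(\<lambda>L. grid_map ` L) ` Z3_hat = Peres_rays"
  unfolding Peres_rays_eq Z3_hat_def Let_def indexed_by_3
  apply (simp only: Un_insert_left Un_empty_left image_insert image_empty
      grid_map_A grid_map_B grid_map_P grid_map_P' Let_def)
  apply (simp add: cos_third_def sin_third_def ray_vector_normalize)
  apply (simp only: Peres_representatives_def image_insert image_empty)
  apply (intro equalityI; simp only: insert_subset empty_subsetI insert_iff simp_thms)
  done

section \<open>Roots of F4 against Peres rays\<close>

lemma Peres_raysI: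
  "ray (axis i 1) \<in> Peres_rays"
  "s2 \<in> {1, -1} \<Longrightarrow> s3 \<in> {1, -1} \<Longrightarrow> s4 \<in> {1, -1} \<Longrightarrow>
     ray (vector [1, s2, s3, s4]) \<in> Peres_rays"
  "s \<in> {1, -1} \<Longrightarrow> i \<noteq> j \<Longrightarrow> ray (axis i 1 + s *\<^sub>R axis j 1) \<in> Peres_rays"
  unfolding Peres_rays_def Un_iff mem_Collect_eq
    apply (rule disjI1, rule disjI1, intro exI conjI, rule refl, rule TrueI)
   apply (rule disjI1, rule disjI2, intro exI conjI, rule refl, assumption+)
  apply (rule disjI2, intro exI conjI, rule refl, assumption+)
  done

lemma F4_rootsI:
  "s \<in> {1, -1} \<Longrightarrow> t \<in> {1, -1} \<Longrightarrow> i \<noteq> j \<Longrightarrow> s *\<^sub>R axis i 1 + t *\<^sub>R axis j 1 \<in> F4_roots"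
  "s \<in> {1, -1} \<Longrightarrow> s *\<^sub>R axis i 1 \<in> F4_roots"
  "s1 \<in> {1, -1} \<Longrightarrow> s2 \<in> {1, -1} \<Longrightarrow> s3 \<in> {1, -1} \<Longrightarrow> s4 \<in> {1, -1} \<Longrightarrow>
     (1 / 2) *\<^sub>R vector [s1, s2, s3, s4] \<in> F4_roots"
  unfolding F4_roots_def Un_iff mem_Collect_eq
    apply (rule disjI1, rule disjI1, intro exI conjI, rule refl, assumption+)
   apply (rule disjI1, rule disjI2, intro exI conjI, rule refl, assumption+)
  apply (rule disjI2, intro exI conjI, rule refl, assumption+)
  done

text \<open>Up to a nonzero factor, a root is determined by its signs relative to the first one, and
  these are the signs in the Peres vectors.\<close>

lemma F4_rays_eq: "F4_rays = Peres_rays"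
proof
  show "F4_rays \<subseteq> Peres_rays"
  proof
    fix L assume "L \<in> F4_rays"
    then obtain v where v: "v \<in> F4_roots" and L: "L = ray v"
      by (auto simp: F4_rays_def)
    from v consider
      (long) s t i j where "v = s *\<^sub>R axis i 1 + t *\<^sub>R axis j 1" "s \<in> {1, -1}" "t \<in> {1, -1}" "i \<noteq> j"
    | (axis) s i where "v = s *\<^sub>R axis i 1" "s \<in> {1, -1}"
    | (half) s1 s2 s3 s4 where "v = (1 / 2) *\<^sub>R vector [s1, s2, s3, s4]"
        "s1 \<in> {1, -1}" "s2 \<in> {1, -1}" "s3 \<in> {1, -1}" "s4 \<in> {1, -1}"
      unfolding F4_roots_def Un_iff mem_Collect_eq
      by - (elim disjE exE conjE; rule that; assumption)
    thus "L \<in> Peres_rays"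
    proof cases
      case long
      \<comment> \<open>As \<open>s * s = 1\<close>, factoring out \<open>s\<close> leaves the
        relative sign \<open>s * t\<close>.\<close>
      have "v = s *\<^sub>R (axis i 1 + (s * t) *\<^sub>R axis j 1)"
        using long by (auto simp: algebra_simps)
      hence "L = ray (axis i 1 + (s * t) *\<^sub>R axis j 1)"
        using long(2) L by (simp only:) (rule ray_scale, auto)
      moreover have "s * t \<in> {1, -1}" using long by auto
      ultimately show ?thesis using \<open>i \<noteq> j\<close> by (simp only: Peres_raysI not_False_eq_True)
    next
      case axis
      hence "L = ray (axis i 1)" using L by (simp only:) (rule ray_scale, auto)
      thus ?thesis by (simp only: Peres_raysI)
    next
      case half
      have "v = (s1 / 2) *\<^sub>R vector [1, s1 * s2, s1 * s3, s1 * s4]"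
        using half by (auto simp: vec_eq_iff forall_4)
      hence "L = ray (vector [1, s1 * s2, s1 * s3, s1 * s4])"
        using half(2) L by (simp only:) (rule ray_scale, auto)
      moreover have "s1 * s2 \<in> {1, -1}" "s1 * s3 \<in> {1, -1}" "s1 * s4 \<in> {1, -1}"
        using half by auto
      ultimately show ?thesis by (simp only: Peres_raysI)
    qed
  qed
  show "Peres_rays \<subseteq> F4_rays"
  proof
    fix L assume "L \<in> Peres_rays"
    then consider
      (axis) i where "L = ray (axis i 1)"
    | (half) s2 s3 s4 where "L = ray (vector [1, s2, s3, s4])"
        "s2 \<in> {1, -1}" "s3 \<in> {1, -1}" "s4 \<in> {1, -1}"
    | (long) s i j where "L = ray (axis i 1 + s *\<^sub>R axis j 1)" "s \<in> {1, -1}" "i \<noteq> j"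
      unfolding Peres_rays_def Un_iff mem_Collect_eq
      by - (elim disjE exE conjE; rule that; assumption)
    thus "L \<in> F4_rays"
    proof cases
      case axis
      have "1 *\<^sub>R axis i 1 \<in> F4_roots" by (rule F4_rootsI) simp
      thus ?thesis using axis by (auto simp: F4_rays_def)
    next
      case half
      have "(1 / 2) *\<^sub>R vector [1, s2, s3, s4] \<in> F4_roots"
        using half(2-) by (intro F4_rootsI) simp_all
      hence "ray ((1 / 2) *\<^sub>R vector [1, s2, s3, s4]) \<in> F4_rays"
        unfolding F4_rays_def by (rule imageI)
      thus ?thesis using half(1) ray_scale[of "1 / 2"] by simp
    next
      case long
      have "1 *\<^sub>R axis i 1 + s *\<^sub>R axis j 1 \<in> F4_roots"
        using long(2-) by (intro F4_rootsI) simp_all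
      thus ?thesis using long(1) by (auto simp: F4_rays_def)
    qed
  qed
qed

theorem theorem7p1:
  shows "orthogonally_equivalent Z3_hat F4_rays \<and>
         orthogonally_equivalent Z3_hat Peres_rays \<and>
         F4_rays = Peres_rays"
  using orthogonal_grid_map grid_map_Z3_hat
  unfolding orthogonally_equivalent_def F4_rays_eq by blast

end
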